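(* Let $\mathcal{C}$ be a small category with weak pullbacks. If an internal frame $L\in\mathsf{Frm}[\mathcal{C}^{op},\mathsf{Set}]$ is (internally) locally compact, then for every $g\colon b\to a$ in $\mathcal{C}$ the transition map $Lg\colon La\to Lb$ preserves the way-below relation of the sections: if $w\ll u$ in $La$, then $Lg(w)\ll Lg(u)$ in $Lb$.
   Context: For an arrow $f$ of $\mathcal{C}$, $\vartheta_0 f$ is its source and $\vartheta_1 f$ its target. An internal frame in $[\mathcal{C}^{op},\mathsf{Set}]$ is (described as) a functor $L$ from $\mathcal{C}^{op}$ to frames such that each $Lf\colon La\to Lb$ ($f\colon b\to a$) has a left adjoint $\Sigma_f\colon Lb\to La$ satisfying the Beck-Chevalley condition $Ls\circ\Sigma_r=\Sigma_q\circ Lp$ for every weak pullback square $rp=sq$ in $\mathcal{C}$, and Frobenius reciprocity $\Sigma_f(Lf(u)\wedge v)=u\wedge\Sigma_f v$. For a lattice $K$, $\mathrm{idl}\,K$ is the poset of ideals of $K$ (subsets containing $0$, downward closed, closed under binary joins) ordered by inclusion; for a map $h\colon K\to K'$ and $I\subseteq K$, $h[I]$ denotes the ideal generated by the direct image of $I$. The way-below relation on a frame: $x\ll y$ iff for every directed $S$ with $y\le\bigvee S$ there is $s\in S$ with $x\le s$. The internal ideal object of an internal frame $L$ is the presheaf of posets $\mathrm{idl}_{\hat{\mathcal{C}}}L$ with $$\mathrm{idl}_{\hat{\mathcal{C}}}L(a)=\Big\{(I_f)_{\vartheta_1 f=a}\ \Big|\ I_f\in\mathrm{idl}(L(\vartheta_0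 f)),\ Lg[I_f]\subseteq I_{fg}\text{ whenever }\vartheta_1 g=\vartheta_0 f\Big\},$$ ordered by componentwise inclusion, with transition along $r\colon b\to a$ given by $(I_f)_{\vartheta_1 f=a}\mapsto(I_{rh})_{\vartheta_1 h=b}$. The internal supremum map $S\colon\mathrm{idl}_{\hat{\mathcal{C}}}L\to L$ is $S_a((I_f)_{\vartheta_1 f=a})=\bigvee\bigcup_{\vartheta_1 f=a}\Sigma_f[I_f]$. The internal frame $L$ is (internally) locally compact if there is a natural transformation of presheaves of posets $\Lambda\colon L\to\mathrm{idl}_{\hat{\mathcal{C}}}L$ left adjoint to $S$ (i.e. $\Lambda_a\dashv S_a$ for all $a$). *)

theory Defs
  imports "HOL-Algebra.Galois_Connection"
begin

section \<open>Small categories and weak pullbacks\<close>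

record ('o, 'm) cat =
  Obj :: "'o set"
  Arr :: "'m set"
  source :: "'m \<Rightarrow> 'o"
  target :: "'m \<Rightarrow> 'o"
  ident :: "'o \<Rightarrow> 'm"
  cmp :: "'m \<Rightarrow> 'm \<Rightarrow> 'm"  (infixl \<open>\<cdot>\<index>\<close> 70)

text \<open>Composition is written in the order of functions: \<open>f \<cdot> g\<close> is ``first \<open>g\<close>, then \<open>f\<close>''
  and is meaningful when \<open>target g = source f\<close>.\<close>

locale small_category =
  fixes C :: "('o, 'm) cat" (structure)
  assumes source_closed: "f \<in> Arr C \<Longrightarrow> source C f \<in> Obj C"
    and target_closed: "f \<in> Arr C \<Longrightarrow> target C f \<in> Obj C"
    and ident_closed: "a \<in> Obj C \<Longrightarrow> ident C a \<in> Arr C"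
    and source_ident: "a \<in> Obj C \<Longrightarrow> source C (ident C a) = a"
    and target_ident: "a \<in> Obj C \<Longrightarrow> target C (ident C a) = a"
    and cmp_closed:
      "\<lbrakk>f \<in> Arr C; g \<in> Arr C; target C g = source C f\<rbrakk> \<Longrightarrow> f \<cdot> g \<in> Arr C"
    and source_cmp:
      "\<lbrakk>f \<in> Arr C; g \<in> Arr C; target C g = source C f\<rbrakk> \<Longrightarrow> source C (f \<cdot> g) = source C g"
    and target_cmp:
      "\<lbrakk>f \<in> Arr C; g \<in> Arr C; target C g = source C f\<rbrakk> \<Longrightarrow> target C (f \<cdot> g) = target C f"
    and ident_left: "f \<in> Arr C \<Longrightarrow> ident C (target C f) \<cdot> f = f"
    and ident_right: "f \<in> Arr C \<Longrightarrow> f \<cdot> ident C (source C f) = f"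
    and cmp_assoc:
      "\<lbrakk>f \<in> Arr C; g \<in> Arr C; h \<in> Arr C; target C g = source C f; target C h = source C g\<rbrakk>
        \<Longrightarrow> (f \<cdot> g) \<cdot> h = f \<cdot> (g \<cdot> h)"

definition arrows_into :: "('o, 'm) cat \<Rightarrow> 'o \<Rightarrow> 'm set"
  where "arrows_into C a = {f \<in> Arr C. target C f = a}"

definition commuting_square :: "('o, 'm) cat \<Rightarrow> 'm \<Rightarrow> 'm \<Rightarrow> 'm \<Rightarrow> 'm \<Rightarrow> bool"
  where "commuting_square C r p s q \<longleftrightarrow>
    r \<in> Arr C \<and> p \<in> Arr C \<and> s \<in> Arr C \<and> q \<in> Arr C \<and>
    target C p = source C r \<and> target C q = source C s \<and>
    source C p = source C q \<and> target C r = target C s \<and>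
    r \<cdot>\<^bsub>C\<^esub> p = s \<cdot>\<^bsub>C\<^esub> q"

text \<open>As opposed to a pullback, the mediating arrow \<open>h\<close> need not be unique.\<close>

definition weak_pullback :: "('o, 'm) cat \<Rightarrow> 'm \<Rightarrow> 'm \<Rightarrow> 'm \<Rightarrow> 'm \<Rightarrow> bool"
  where "weak_pullback C r p s q \<longleftrightarrow>
    commuting_square C r p s q \<and>
    (\<forall>x y. commuting_square C r x s y \<longrightarrow>
      (\<exists>h \<in> Arr C. source C h = source C x \<and> target C h = source C p \<and>
        p \<cdot>\<^bsub>C\<^esub> h = x \<and> q \<cdot>\<^bsub>C\<^esub> h = y))"

definition has_weak_pullbacks :: "('o, 'm) cat \<Rightarrow> bool"
  where "has_weak_pullbacks C \<longleftrightarrow>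
    (\<forall>r \<in> Arr C. \<forall>s \<in> Arr C. target C r = target C s \<longrightarrow> (\<exists>p q. weak_pullback C r p s q))"


section \<open>Frames, the way-below relation, and ideals\<close>

locale frame = complete_lattice +
  assumes meet_sup_distrib:
    "\<lbrakk>x \<in> carrier L; A \<subseteq> carrier L\<rbrakk> \<Longrightarrow> x \<sqinter> \<Squnion>A = \<Squnion>((\<lambda>y. x \<sqinter> y) ` A)"

definition frame_hom :: "'a gorder \<Rightarrow> 'b gorder \<Rightarrow> ('a \<Rightarrow> 'b) \<Rightarrow> bool"
  where "frame_hom K K' h \<longleftrightarrow>
    frame K \<and> frame K' \<and> h \<in> carrier K \<rightarrow> carrier K' \<and>
    h \<top>\<^bsub>K\<^esub> = \<top>\<^bsub>K'\<^esub> \<and> meet_pres K K' h \<and> sup_pres K K' h"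

definition directed :: "'a gorder \<Rightarrow> 'a set \<Rightarrow> bool"
  where "directed K D \<longleftrightarrow>
    D \<subseteq> carrier K \<and> D \<noteq> {} \<and> (\<forall>x \<in> D. \<forall>y \<in> D. \<exists>z \<in> D. x \<sqsubseteq>\<^bsub>K\<^esub> z \<and> y \<sqsubseteq>\<^bsub>K\<^esub> z)"

definition way_below :: "'a gorder \<Rightarrow> 'a \<Rightarrow> 'a \<Rightarrow> bool"  (infix \<open>\<lless>\<index>\<close> 50)
  where "x \<lless>\<^bsub>K\<^esub> y \<longleftrightarrow> (\<forall>D. directed K D \<and> y \<sqsubseteq>\<^bsub>K\<^esub> \<Squnion>\<^bsub>K\<^esub>D \<longrightarrow> (\<exists>s \<in> D. x \<sqsubseteq>\<^bsub>K\<^esub> s))"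

definition idl :: "'a gorder \<Rightarrow> 'a set set"
  where "idl K = {I. I \<subseteq> carrier K \<and> \<bottom>\<^bsub>K\<^esub> \<in> I \<and>
    (\<forall>x \<in> I. \<forall>y \<in> carrier K. y \<sqsubseteq>\<^bsub>K\<^esub> x \<longrightarrow> y \<in> I) \<and>
    (\<forall>x \<in> I. \<forall>y \<in> I. x \<squnion>\<^bsub>K\<^esub> y \<in> I)}"

definition ideal_gen :: "'a gorder \<Rightarrow> 'a set \<Rightarrow> 'a set"
  where "ideal_gen K A = \<Inter>{I \<in> idl K. A \<subseteq> I}"


section \<open>Presheaves of posets\<close>

text \<open>A presheaf has an ordered set of sections \<open>sections P a\<close> for each object \<open>a\<close>, and
  \<open>transition P f\<close> goes from \<open>sections P (target f)\<close> to \<open>sections P (source f)\<close>. Having all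
  sections in one type \<open>'x\<close> is no restriction, as they are sets with their own carriers.\<close>

record ('o, 'm, 'x) presheaf =
  sections :: "'o \<Rightarrow> 'x gorder"
  transition :: "'m \<Rightarrow> 'x \<Rightarrow> 'x"

locale poset_presheaf = small_category C
  for C :: "('o, 'm) cat" (structure) +
  fixes P :: "('o, 'm, 'x) presheaf"
  assumes sections_order: "a \<in> Obj C \<Longrightarrow> partial_order (sections P a)"
    and transition_closed: "f \<in> Arr C \<Longrightarrow>
      transition P f \<in> carrier (sections P (target C f)) \<rightarrow> carrier (sections P (source C f))"
    and transition_isotone: "f \<in> Arr C \<Longrightarrow>
      isotone (sections P (target C f)) (sections P (source C f)) (transition P f)"
    and transition_ident:
      "\<lbrakk>a \<in> Obj C; u \<in> carrier (sections P a)\<rbrakk> \<Longrightarrow> transition P (ident C a) u = u"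
    and transition_cmp:
      "\<lbrakk>f \<in> Arr C; g \<in> Arr C; target C g = source C f; u \<in> carrier (sections P (target C f))\<rbrakk>
        \<Longrightarrow> transition P (f \<cdot> g) u = transition P g (transition P f u)"

definition poset_presheaf_hom ::
    "('o, 'm) cat \<Rightarrow> ('o, 'm, 'x) presheaf \<Rightarrow> ('o, 'm, 'y) presheaf \<Rightarrow> ('o \<Rightarrow> 'x \<Rightarrow> 'y) \<Rightarrow> bool"
  where "poset_presheaf_hom C P Q \<tau> \<longleftrightarrow>
    (\<forall>a \<in> Obj C. \<tau> a \<in> carrier (sections P a) \<rightarrow> carrier (sections Q a) \<and>
      isotone (sections P a) (sections Q a) (\<tau> a)) \<and>
    (\<forall>f \<in> Arr C. \<forall>u \<in> carrier (sections P (target C f)).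
      \<tau> (source C f) (transition P f u) = transition Q f (\<tau> (target C f) u))"


section \<open>Internal frames and local compactness\<close>

definition left_adjoint :: "'a gorder \<Rightarrow> 'b gorder \<Rightarrow> ('a \<Rightarrow> 'b) \<Rightarrow> ('b \<Rightarrow> 'a) \<Rightarrow> bool"
  where "left_adjoint A B l r \<longleftrightarrow>
    galois_connection \<lparr>orderA = A, orderB = B, lower = l, upper = r\<rparr>"

text \<open>The left adjoints \<open>Sig f\<close> are uniquely determined by \<open>L\<close> on the carriers; they are kept as
  a parameter only to have a name for them.\<close>

locale internal_frame = poset_presheaf C L
  for C :: "('o, 'm) cat" (structure) and L :: "('o, 'm, 'x) presheaf" +
  fixes Sig :: "'m \<Rightarrow> 'x \<Rightarrow> 'x"
  assumes sections_frame: "a \<in> Obj C \<Longrightarrow> frame (sections L a)"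
    and transition_frame_hom: "f \<in> Arr C \<Longrightarrow>
      frame_hom (sections L (target C f)) (sections L (source C f)) (transition L f)"
    and Sig_left_adjoint: "f \<in> Arr C \<Longrightarrow>
      left_adjoint (sections L (source C f)) (sections L (target C f)) (Sig f) (transition L f)"
    and Beck_Chevalley:
      "\<lbrakk>weak_pullback C r p s q; u \<in> carrier (sections L (source C r))\<rbrakk>
        \<Longrightarrow> transition L s (Sig r u) = Sig q (transition L p u)"
    and Frobenius:
      "\<lbrakk>f \<in> Arr C; u \<in> carrier (sections L (target C f)); v \<in> carrier (sections L (source C f))\<rbrakk>
        \<Longrightarrow> Sig f (transition L f u \<sqinter>\<^bsub>sections L (source C f)\<^esub> v)
          = u \<sqinter>\<^bsub>sections L (target C f)\<^esub> Sig f v"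

text \<open>Families indexed by the arrows into \<open>a\<close> are extensional functions (\<open>undefined\<close> off the
  index set), so that equality of families is equality of functions.\<close>

definition idl_families :: "('o, 'm) cat \<Rightarrow> ('o, 'm, 'x) presheaf \<Rightarrow> 'o \<Rightarrow> ('m \<Rightarrow> 'x set) set"
  where "idl_families C L a =
    {I \<in> (\<Pi>\<^sub>E f \<in> arrows_into C a. idl (sections L (source C f))).
      \<forall>f \<in> arrows_into C a. \<forall>g \<in> arrows_into C (source C f).
        ideal_gen (sections L (source C g)) (transition L g ` I f) \<subseteq> I (f \<cdot>\<^bsub>C\<^esub> g)}"

definition idl_presheaf ::
    "('o, 'm) cat \<Rightarrow> ('o, 'm, 'x) presheaf \<Rightarrow> ('o, 'm, 'm \<Rightarrow> 'x set) presheaf"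
  where "idl_presheaf C L =
    \<lparr>sections = (\<lambda>a. \<lparr>carrier = idl_families C L a, eq = (=),
                       le = (\<lambda>I J. \<forall>f \<in> arrows_into C a. I f \<subseteq> J f)\<rparr>),
     transition = (\<lambda>r I. restrict (\<lambda>h. I (r \<cdot>\<^bsub>C\<^esub> h)) (arrows_into C (source C r)))\<rparr>"

definition internal_sup ::
    "('o, 'm) cat \<Rightarrow> ('o, 'm, 'x) presheaf \<Rightarrow> ('m \<Rightarrow> 'x \<Rightarrow> 'x) \<Rightarrow> 'o \<Rightarrow> ('m \<Rightarrow> 'x set) \<Rightarrow> 'x"
  where "internal_sup C L Sig a I =
    \<Squnion>\<^bsub>sections L a\<^esub>(\<Union>f \<in> arrows_into C a. ideal_gen (sections L a) (Sig f ` I f))"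

definition internally_locally_compact ::
    "('o, 'm) cat \<Rightarrow> ('o, 'm, 'x) presheaf \<Rightarrow> ('m \<Rightarrow> 'x \<Rightarrow> 'x) \<Rightarrow> bool"
  where "internally_locally_compact C L Sig \<longleftrightarrow>
    (\<exists>\<Lambda>. poset_presheaf_hom C L (idl_presheaf C L) \<Lambda> \<and>
      (\<forall>a \<in> Obj C. left_adjoint (sections L a) (sections (idl_presheaf C L) a)
        (\<Lambda> a) (internal_sup C L Sig a)))"

end

theory Submission
  imports Defs
begin

text \<open>Write \<open>\<Lambda>\<close> for the left adjoint of the internal supremum map \<open>S\<close>. The components of the
  family \<open>\<Lambda>\<^sub>b v\<close> consist of elements that are way below \<open>v\<close> once they are pushed down to \<open>b\<close>:
  if \<open>y \<in> (\<Lambda>\<^sub>b v)\<^sub>q\<close>, then \<open>\<Sigma>\<^sub>q y \<lless> v\<close> (lemma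
  \<open>Sig_left_adjoint_way_below\<close>). Indeed, a directed set \<open>D\<close> in
  \<open>L b\<close> with \<open>v \<sqsubseteq> \<Squnion>D\<close> gives a family of ideals, at \<open>q\<close> the ideal generated by \<open>Lq[D]\<close>,
  whose internal supremum is at least \<open>\<Squnion>D\<close>; by the adjunction \<open>\<Lambda>\<^sub>b v\<close> lies below this family,
  so that \<open>y \<sqsubseteq> Lq d\<close>, that is \<open>\<Sigma>\<^sub>q y \<sqsubseteq> d\<close>, for some \<open>d \<in> D\<close>.

  Now let \<open>g : b \<rightarrow> a\<close> and \<open>w \<lless> u\<close> in \<open>L a\<close>. For \<open>x \<in> (\<Lambda>\<^sub>a u)\<^sub>f\<close> choose a weak pullback
  \<open>f p = g q\<close>. By the Beck-Chevalley condition \<open>Lg (\<Sigma>\<^sub>f x) = \<Sigma>\<^sub>q (Lp x)\<close>, and by naturality of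
  \<open>\<Lambda>\<close> the element \<open>Lp x\<close> belongs to \<open>(\<Lambda>\<^sub>a u)\<^bsub>f p\<^esub> = (\<Lambda>\<^sub>a u)\<^bsub>g q\<^esub> = (\<Lambda>\<^sub>b (Lg u))\<^sub>q\<close>. Hence
  \<open>Lg (\<Sigma>\<^sub>f x) \<lless> Lg u\<close> (lemma \<open>transition_Sig_way_below\<close>). Therefore all these \<open>\<Sigma>\<^sub>f x\<close> belong to
  \<open>W = {z. Lg z \<lless> Lg u}\<close>, which is an ideal because \<open>Lg\<close> preserves finite joins. Their supremum
  \<open>S\<^sub>a (\<Lambda>\<^sub>a u)\<close> is at least \<open>u\<close> by the unit of the adjunction, so \<open>u \<sqsubseteq> \<Squnion>W\<close>. As ideals are
  directed, \<open>w \<lless> u\<close> puts \<open>w\<close> below an element of \<open>W\<close>, and thus into \<open>W\<close>.\<close>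

section \<open>Ideals and directed sets\<close>

lemma ideal_gen_subset:
  assumes "I \<in> idl K" "A \<subseteq> I"
  shows "ideal_gen K A \<subseteq> I"
  using assms unfolding ideal_gen_def by blast

lemma subset_ideal_gen: "A \<subseteq> ideal_gen K A"
  unfolding ideal_gen_def by blast

lemma directed_image:
  assumes "directed K D" "isotone K K' h" "h \<in> carrier K \<rightarrow> carrier K'"
  shows "directed K' (h ` D)"
  unfolding directed_def
proof (intro conjI ballI)
  show "h ` D \<subseteq> carrier K'" "h ` D \<noteq> {}"
    using assms unfolding directed_def by auto
  fix x' y' assume "x' \<in> h ` D" "y' \<in> h ` D"
  then obtain x y where xy: "x \<in> D" "y \<in> D" "x' = h x" "y' = h y" by blast
  then obtain z where "z \<in> D" "x \<sqsubseteq>\<^bsub>K\<^esub> z" "y \<sqsubseteq>\<^bsub>K\<^esub> z"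
    using assms(1) unfolding directed_def by blast
  moreover have "D \<subseteq> carrier K" using assms(1) unfolding directed_def by blast
  ultimately have "h z \<in> h ` D" "x' \<sqsubseteq>\<^bsub>K'\<^esub> h z" "y' \<sqsubseteq>\<^bsub>K'\<^esub> h z"
    using xy assms(2) unfolding isotone_def by blast+
  then show "\<exists>z' \<in> h ` D. x' \<sqsubseteq>\<^bsub>K'\<^esub> z' \<and> y' \<sqsubseteq>\<^bsub>K'\<^esub> z'" by blast
qed

definition down_closure :: "'a gorder \<Rightarrow> 'a set \<Rightarrow> 'a set"
  where "down_closure K D = {x \<in> carrier K. \<exists>d \<in> D. x \<sqsubseteq>\<^bsub>K\<^esub> d}"

context
  fixes K :: "'a gorder" (structure)
  assumes complete: "complete_lattice K"
begin

interpretation K: complete_lattice K by (fact complete)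

lemma ideal_gen_closed:
  assumes "A \<subseteq> carrier K"
  shows "ideal_gen K A \<subseteq> carrier K"
proof (rule ideal_gen_subset)
  show "carrier K \<in> idl K" unfolding idl_def by auto
qed (fact assms)

lemma directed_idl:
  assumes "I \<in> idl K"
  shows "directed K I"
  unfolding directed_def
proof (intro conjI ballI)
  show "I \<subseteq> carrier K" "I \<noteq> {}" using assms unfolding idl_def by auto
  fix x y assume xy: "x \<in> I" "y \<in> I"
  then have "x \<in> carrier K" "y \<in> carrier K" "x \<squnion> y \<in> I"
    using assms unfolding idl_def by auto
  then show "\<exists>z \<in> I. x \<sqsubseteq> z \<and> y \<sqsubseteq> z"
    using K.join_left K.join_right by blast
qed

lemma down_closure_directed_idl:
  assumes D: "directed K D"
  shows "down_closure K D \<in> idl K"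
proof -
  have carr: "D \<subseteq> carrier K" "D \<noteq> {}" using D unfolding directed_def by auto
  have "x \<squnion> y \<in> down_closure K D"
    if xy: "x \<in> down_closure K D" "y \<in> down_closure K D" for x y
  proof -
    obtain d e where de: "d \<in> D" "e \<in> D" "x \<sqsubseteq> d" "y \<sqsubseteq> e"
      and xyc: "x \<in> carrier K" "y \<in> carrier K"
      using xy unfolding down_closure_def by blast
    then obtain z where z: "z \<in> D" "d \<sqsubseteq> z" "e \<sqsubseteq> z"
      using D unfolding directed_def by blast
    have "x \<sqsubseteq> z" "y \<sqsubseteq> z"
      using K.le_trans[OF de(3) z(2)] K.le_trans[OF de(4) z(3)] de z xyc carr by auto
    then have "x \<squnion> y \<sqsubseteq> z" using xyc z carr K.join_le by blast
    then show ?thesis using xyc z unfolding down_closure_def by auto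
  qed
  moreover have "\<bottom> \<in> down_closure K D"
    using carr unfolding down_closure_def by blast
  moreover have "y \<in> down_closure K D"
    if xy: "x \<in> down_closure K D" "y \<in> carrier K" "y \<sqsubseteq> x" for x y
  proof -
    obtain d where d: "d \<in> D" "x \<sqsubseteq> d" "x \<in> carrier K"
      using xy(1) unfolding down_closure_def by blast
    then have "y \<sqsubseteq> d" using K.le_trans[OF xy(3) d(2)] xy carr by auto
    then show ?thesis using d xy unfolding down_closure_def by blast
  qed
  ultimately show ?thesis
    unfolding idl_def by (auto simp: down_closure_def)
qed

text \<open>The bottom element is way below everything because directed sets are nonempty; closure
  under joins uses that any two members of a directed set have an upper bound in it.\<close>

lemma way_below_idl:
  assumes v: "v \<in> carrier K"
  shows "{x \<in> carrier K. x \<lless> v} \<in> idl K"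
proof -
  have "\<bottom> \<lless> v"
    unfolding way_below_def directed_def using K.bottom_lower by fast
  moreover have "y \<lless> v"
    if xy: "x \<in> carrier K" "x \<lless> v" "y \<in> carrier K" "y \<sqsubseteq> x" for x y
    unfolding way_below_def
  proof (intro allI impI)
    fix D assume D: "directed K D \<and> v \<sqsubseteq> \<Squnion>D"
    then obtain d where "d \<in> D" "x \<sqsubseteq> d" using xy unfolding way_below_def by blast
    moreover have "D \<subseteq> carrier K" using D unfolding directed_def by blast
    ultimately show "\<exists>s \<in> D. y \<sqsubseteq> s" using xy K.le_trans by blast
  qed
  moreover have "x \<squnion> y \<lless> v"
    if xy: "x \<in> carrier K" "x \<lless> v" "y \<in> carrier K" "y \<lless> v" for x y
    unfolding way_below_def
  proof (intro allI impI)
    fix D assume D: "directed K D \<and> v \<sqsubseteq> \<Squnion>D"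
    then obtain d e where de: "d \<in> D" "e \<in> D" "x \<sqsubseteq> d" "y \<sqsubseteq> e"
      using xy unfolding way_below_def by blast
    then obtain z where z: "z \<in> D" "d \<sqsubseteq> z" "e \<sqsubseteq> z"
      using D unfolding directed_def by blast
    have carr: "D \<subseteq> carrier K" using D unfolding directed_def by blast
    then have "d \<in> carrier K" "e \<in> carrier K" "z \<in> carrier K" using de z by auto
    then have "x \<sqsubseteq> z" "y \<sqsubseteq> z"
      using K.le_trans[OF de(3) z(2)] K.le_trans[OF de(4) z(3)] xy by auto
    then show "\<exists>s \<in> D. x \<squnion> y \<sqsubseteq> s" using xy z carr K.join_le by blast
  qed
  ultimately show ?thesis unfolding idl_def by auto
qed

end

lemma sup_pres_vimage_idl:
  assumes h: "sup_pres K K' h" "h \<in> carrier K \<rightarrow> carrier K'" and J: "J \<in> idl K'"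
  shows "{x \<in> carrier K. h x \<in> J} \<in> idl K"
proof -
  interpret K: complete_lattice K using h unfolding sup_pres_def by blast
  interpret K': complete_lattice K' using h unfolding sup_pres_def by blast
  have join: "join_pres K K' h"
    using h(1) by (blast intro: sup_pres_is_join_pres weak_sup_pres)
  have iso: "isotone K K' h" using h(2) join by (rule join_pres_isotone)
  \<comment> \<open>The least element is the supremum of the empty set.\<close>
  have "h (\<Squnion>\<^bsub>K\<^esub>{}) = \<Squnion>\<^bsub>K'\<^esub>{}"
    using h(1) unfolding sup_pres_def by (metis empty_subsetI image_empty)
  then have "h \<bottom>\<^bsub>K\<^esub> = \<bottom>\<^bsub>K'\<^esub>"
    using K.weak_sup_empty K'.weak_sup_empty by (simp add: K.eq_is_equal K'.eq_is_equal)
  moreover have "h (x \<squnion>\<^bsub>K\<^esub> y) = h x \<squnion>\<^bsub>K'\<^esub> h y"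
    if "x \<in> carrier K" "y \<in> carrier K" for x y
    using that join unfolding join_pres_def by blast
  moreover have "h y \<in> J"
    if "x \<in> carrier K" "h x \<in> J" "y \<in> carrier K" "y \<sqsubseteq>\<^bsub>K\<^esub> x" for x y
    using that iso J h(2) unfolding idl_def isotone_def by blast
  ultimately show ?thesis
    using J unfolding idl_def by auto
qed


section \<open>The left adjoint of the internal supremum map\<close>

text \<open>For a directed set \<open>D\<close> of sections over \<open>a\<close> this is the least family of ideals over \<open>a\<close> whose
  component at the identity contains \<open>D\<close>. It is the internal counterpart of the ideal
  generated by \<open>D\<close>. The image of \<open>D\<close> under each transition map is again directed, so taking
  the downward closure is enough to generate an ideal.\<close>

definition generated_family ::
    "('o, 'm) cat \<Rightarrow> ('o, 'm, 'x) presheaf \<Rightarrow> 'o \<Rightarrow> 'x set \<Rightarrow> 'm \<Rightarrow> 'x set"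
  where "generated_family C L a D =
    (\<lambda>f \<in> arrows_into C a. down_closure (sections L (source C f)) (transition L f ` D))"

context internal_frame
begin

lemma sections_complete: "a \<in> Obj C \<Longrightarrow> complete_lattice (sections L a)"
  using sections_frame unfolding frame_def by blast

lemma Sig_closed:
  assumes "f \<in> Arr C" "x \<in> carrier (sections L (source C f))"
  shows "Sig f x \<in> carrier (sections L (target C f))"
  using Sig_left_adjoint[OF assms(1)] assms(2) connection.lower_closed
  unfolding left_adjoint_def galois_connection_def by fastforce

lemma Sig_le_iff:
  assumes "f \<in> Arr C" "x \<in> carrier (sections L (source C f))"
    "z \<in> carrier (sections L (target C f))"
  shows "Sig f x \<sqsubseteq>\<^bsub>sections L (target C f)\<^esub> z
    \<longleftrightarrow> x \<sqsubseteq>\<^bsub>sections L (source C f)\<^esub> transition L f z"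
  using galois_connection.galois_property[OF Sig_left_adjoint[OF assms(1), unfolded left_adjoint_def]]
    assms(2,3) by simp

lemma idl_families_component:
  assumes "I \<in> idl_families C L a" "f \<in> arrows_into C a"
  shows "I f \<in> idl (sections L (source C f))"
  using assms unfolding idl_families_def by auto

lemma idl_families_transition:
  assumes "I \<in> idl_families C L a" "f \<in> arrows_into C a" "g \<in> arrows_into C (source C f)"
  shows "ideal_gen (sections L (source C g)) (transition L g ` I f) \<subseteq> I (f \<cdot> g)"
  using assms unfolding idl_families_def by simp

lemma generated_family_in_idl_families:
  assumes a: "a \<in> Obj C" and D: "directed (sections L a) D"
  shows "generated_family C L a D \<in> idl_families C L a"
proof -
  have idl: "generated_family C L a D f \<in> idl (sections L (source C f))"
    if f: "f \<in> arrows_into C a" for f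
  proof -
    have f': "f \<in> Arr C" "target C f = a" using f unfolding arrows_into_def by auto
    then have "directed (sections L (source C f)) (transition L f ` D)"
      using directed_image[OF D] transition_isotone[of f] transition_closed[of f] by simp
    then show ?thesis
      using f f' sections_complete[OF source_closed] down_closure_directed_idl
      unfolding generated_family_def by auto
  qed
  moreover have "ideal_gen (sections L (source C g)) (transition L g ` generated_family C L a D f)
      \<subseteq> generated_family C L a D (f \<cdot> g)"
    if f: "f \<in> arrows_into C a" and g: "g \<in> arrows_into C (source C f)" for f g
  proof -
    have f': "f \<in> Arr C" "target C f = a" and g': "g \<in> Arr C" "target C g = source C f"
      using f g unfolding arrows_into_def by auto
    then have fg: "f \<cdot> g \<in> arrows_into C a" "source C (f \<cdot> g) = source C g"
      unfolding arrows_into_def by (auto simp: cmp_closed target_cmp source_cmp)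
    have "transition L g ` generated_family C L a D f \<subseteq> generated_family C L a D (f \<cdot> g)"
    proof
      fix y assume "y \<in> transition L g ` generated_family C L a D f"
      then obtain x d where x: "y = transition L g x" "x \<in> carrier (sections L (source C f))"
        and d: "d \<in> D" "x \<sqsubseteq>\<^bsub>sections L (source C f)\<^esub> transition L f d"
        using f unfolding generated_family_def down_closure_def by auto
      have dc: "d \<in> carrier (sections L a)" using d D unfolding directed_def by blast
      then have fd: "transition L f d \<in> carrier (sections L (source C f))"
        using transition_closed[OF f'(1)] f' by auto
      have "y \<sqsubseteq>\<^bsub>sections L (source C g)\<^esub> transition L g (transition L f d)"
        using transition_isotone[OF g'(1)] g' x d fd unfolding isotone_def by simp
      then have "y \<sqsubseteq>\<^bsub>sections L (source C g)\<^esub> transition L (f \<cdot> g) d"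
        using transition_cmp f' g' dc by simp
      moreover have "y \<in> carrier (sections L (source C g))"
        using transition_closed[OF g'(1)] g' x by auto
      ultimately show "y \<in> generated_family C L a D (f \<cdot> g)"
        using d fg unfolding generated_family_def down_closure_def by auto
    qed
    then show ?thesis using idl[OF fg(1)] fg(2) by (simp add: ideal_gen_subset)
  qed
  ultimately show ?thesis
    unfolding idl_families_def by (auto simp: generated_family_def)
qed

lemma Sig_image_subset_carrier:
  assumes "I \<in> idl_families C L a" "f \<in> arrows_into C a"
  shows "Sig f ` I f \<subseteq> carrier (sections L a)"
  using Sig_closed[of f] idl_families_component[OF assms] assms(2)
  unfolding idl_def arrows_into_def by auto

lemma internal_sup_closed:
  assumes a: "a \<in> Obj C" and I: "I \<in> idl_families C L a"
  shows "internal_sup C L Sig a I \<in> carrier (sections L a)"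
proof -
  interpret K: complete_lattice "sections L a" using a by (rule sections_complete)
  show ?thesis
    unfolding internal_sup_def
    using ideal_gen_closed[OF sections_complete[OF a] Sig_image_subset_carrier[OF I]]
    by (intro K.sup_closed) blast
qed

lemma Sig_le_internal_sup:
  assumes a: "a \<in> Obj C" and I: "I \<in> idl_families C L a"
    and f: "f \<in> arrows_into C a" and x: "x \<in> I f"
  shows "Sig f x \<sqsubseteq>\<^bsub>sections L a\<^esub> internal_sup C L Sig a I"
proof -
  interpret K: complete_lattice "sections L a" using a by (rule sections_complete)
  have "ideal_gen (sections L a) (Sig h ` I h) \<subseteq> carrier (sections L a)"
    if "h \<in> arrows_into C a" for h
    using ideal_gen_closed[OF sections_complete[OF a] Sig_image_subset_carrier[OF I that]] .
  moreover have "Sig f x \<in> ideal_gen (sections L a) (Sig f ` I f)"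
    using x by (intro subsetD[OF subset_ideal_gen] imageI)
  ultimately show ?thesis
    unfolding internal_sup_def using f by (intro K.sup_upper) auto
qed

lemma internal_sup_le_Sup_idl:
  assumes a: "a \<in> Obj C" and J: "J \<in> idl (sections L a)"
    and sub: "\<And>f. f \<in> arrows_into C a \<Longrightarrow> Sig f ` I f \<subseteq> J"
  shows "internal_sup C L Sig a I \<sqsubseteq>\<^bsub>sections L a\<^esub> \<Squnion>\<^bsub>sections L a\<^esub>J"
proof -
  interpret K: complete_lattice "sections L a" using a by (rule sections_complete)
  have "(\<Union>f \<in> arrows_into C a. ideal_gen (sections L a) (Sig f ` I f)) \<subseteq> J"
    using ideal_gen_subset[OF J] sub by blast
  moreover have "J \<subseteq> carrier (sections L a)" using J unfolding idl_def by blast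
  ultimately show ?thesis
    unfolding internal_sup_def
    by (intro K.sup_least) (auto intro: K.sup_upper K.sup_closed)
qed

text \<open>The component at the identity arrow suffices: it contains \<open>D\<close>, and \<open>\<Sigma>\<close> of the identity is
  the identity, being left adjoint to it.\<close>

lemma Sup_le_internal_sup_generated_family:
  assumes a: "a \<in> Obj C" and D: "directed (sections L a) D"
  shows "\<Squnion>\<^bsub>sections L a\<^esub>D \<sqsubseteq>\<^bsub>sections L a\<^esub> internal_sup C L Sig a (generated_family C L a D)"
    (is "_ \<sqsubseteq>\<^bsub>_\<^esub> ?s")
proof -
  interpret K: complete_lattice "sections L a" using a by (rule sections_complete)
  have carr: "D \<subseteq> carrier (sections L a)" using D unfolding directed_def by blast
  let ?i = "ident C a"
  have i: "?i \<in> Arr C" "?i \<in> arrows_into C a" "source C ?i = a" "target C ?i = a"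
    using a unfolding arrows_into_def by (auto simp: ident_closed source_ident target_ident)
  have fam: "generated_family C L a D \<in> idl_families C L a"
    using a D by (rule generated_family_in_idl_families)
  have s: "?s \<in> carrier (sections L a)" using a fam by (rule internal_sup_closed)
  have "d \<sqsubseteq>\<^bsub>sections L a\<^esub> ?s" if d: "d \<in> D" for d
  proof -
    have dc: "d \<in> carrier (sections L a)" using d carr by blast
    have "transition L ?i d = d" using a dc by (rule transition_ident)
    then have "d \<in> transition L ?i ` D" using d by (metis image_eqI)
    then have "d \<in> down_closure (sections L a) (transition L ?i ` D)"
      using dc K.refl unfolding down_closure_def by blast
    then have "d \<in> generated_family C L a D ?i"
      using i unfolding generated_family_def by simp
    then have "Sig ?i d \<sqsubseteq>\<^bsub>sections L a\<^esub> ?s"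
      by (rule Sig_le_internal_sup[OF a fam i(2)])
    then have "d \<sqsubseteq>\<^bsub>sections L a\<^esub> transition L ?i ?s"
      using Sig_le_iff[of ?i d ?s] i dc s by simp
    then show ?thesis using transition_ident[OF a s] by simp
  qed
  then show ?thesis using carr s by (intro K.sup_least)
qed

text \<open>An external directed set \<open>D\<close> with \<open>v \<sqsubseteq> \<Squnion>D\<close> becomes an internal one through its generated
  family \<open>G\<close>: as \<open>v\<close> lies below the internal supremum of \<open>G\<close>, the adjunction gives \<open>l v \<le> G\<close>.
  Hence \<open>y\<close> lies below the restriction along \<open>q\<close> of some \<open>d \<in> D\<close>, and transposing along
  the adjunction between \<open>\<Sigma>\<^sub>q\<close> and \<open>Lq\<close> gives \<open>\<Sigma>\<^sub>q y \<sqsubseteq> d\<close>.\<close>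

lemma Sig_left_adjoint_way_below:
  assumes b: "b \<in> Obj C"
    and adj: "left_adjoint (sections L b) (sections (idl_presheaf C L) b)
      l (internal_sup C L Sig b)"
    and v: "v \<in> carrier (sections L b)" and q: "q \<in> arrows_into C b" and y: "y \<in> l v q"
  shows "Sig q y \<lless>\<^bsub>sections L b\<^esub> v"
  unfolding way_below_def
proof (intro allI impI)
  interpret K: complete_lattice "sections L b" using b by (rule sections_complete)
  fix D assume D: "directed (sections L b) D \<and> v \<sqsubseteq>\<^bsub>sections L b\<^esub> \<Squnion>\<^bsub>sections L b\<^esub>D"
  let ?G = "generated_family C L b D"
  interpret G: galois_connection "\<lparr>orderA = sections L b,
      orderB = sections (idl_presheaf C L) b, lower = l, upper = internal_sup C L Sig b\<rparr>"
    using adj unfolding left_adjoint_def .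
  have carr: "D \<subseteq> carrier (sections L b)" using D unfolding directed_def by blast
  have q': "q \<in> Arr C" "target C q = b" using q unfolding arrows_into_def by auto
  have G: "?G \<in> carrier (sections (idl_presheaf C L) b)"
    using b D generated_family_in_idl_families by (simp add: idl_presheaf_def)
  have "\<Squnion>\<^bsub>sections L b\<^esub>D \<sqsubseteq>\<^bsub>sections L b\<^esub> internal_sup C L Sig b ?G"
    using b D by (intro Sup_le_internal_sup_generated_family) auto
  moreover have "internal_sup C L Sig b ?G \<in> carrier (sections L b)"
    using G.upper_closed G by simp
  ultimately have "v \<sqsubseteq>\<^bsub>sections L b\<^esub> internal_sup C L Sig b ?G"
    using D v carr K.le_trans[of v "\<Squnion>\<^bsub>sections L b\<^esub>D"] by simp
  then have "l v \<sqsubseteq>\<^bsub>sections (idl_presheaf C L) b\<^esub> ?G"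
    using G.left G v by simp
  then have "y \<in> ?G q"
    using q y by (auto simp: idl_presheaf_def)
  then obtain d where d: "d \<in> D" "y \<sqsubseteq>\<^bsub>sections L (source C q)\<^esub> transition L q d"
    and "y \<in> carrier (sections L (source C q))"
    using q unfolding generated_family_def down_closure_def by auto
  then have "Sig q y \<sqsubseteq>\<^bsub>sections L b\<^esub> d"
    using Sig_le_iff[of q y d] q' carr by auto
  then show "\<exists>s \<in> D. Sig q y \<sqsubseteq>\<^bsub>sections L b\<^esub> s" using d by blast
qed

text \<open>Naturality of \<open>\<Lambda>\<close> identifies the component of \<open>\<Lambda> u\<close> at \<open>g \<cdot> q\<close> with the component of
  \<open>\<Lambda> (Lg u)\<close> at \<open>q\<close>. A weak pullback of \<open>f\<close> along \<open>g\<close> carries \<open>x\<close> from the component at \<open>f\<close>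
  there, while Beck-Chevalley rewrites \<open>Lg (\<Sigma>\<^sub>f x)\<close> as a \<open>\<Sigma>\<^sub>q\<close>, so that the preceding lemma
  applies over the source of \<open>g\<close>.\<close>

lemma transition_Sig_way_below:
  assumes wp: "has_weak_pullbacks C"
    and hom: "poset_presheaf_hom C L (idl_presheaf C L) \<Lambda>"
    and adj: "\<And>c. c \<in> Obj C \<Longrightarrow> left_adjoint (sections L c) (sections (idl_presheaf C L) c)
      (\<Lambda> c) (internal_sup C L Sig c)"
    and g: "g \<in> Arr C" and u: "u \<in> carrier (sections L (target C g))"
    and f: "f \<in> arrows_into C (target C g)" and x: "x \<in> \<Lambda> (target C g) u f"
  shows "transition L g (Sig f x) \<lless>\<^bsub>sections L (source C g)\<^esub> transition L g u"
proof -
  have f': "f \<in> Arr C" "target C f = target C g" using f unfolding arrows_into_def by auto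
  obtain p q where pq: "weak_pullback C f p g q"
    using wp f' g unfolding has_weak_pullbacks_def by blast
  then have p: "p \<in> Arr C" "target C p = source C f" and q: "q \<in> Arr C" "target C q = source C g"
    and eq: "f \<cdot> p = g \<cdot> q"
    unfolding weak_pullback_def commuting_square_def by auto
  have p': "p \<in> arrows_into C (source C f)" and q': "q \<in> arrows_into C (source C g)"
    using p q unfolding arrows_into_def by auto
  have fam: "\<Lambda> (target C g) u \<in> idl_families C L (target C g)"
    using hom g u target_closed unfolding poset_presheaf_hom_def by (auto simp: idl_presheaf_def)
  then have xc: "x \<in> carrier (sections L (source C f))"
    using idl_families_component[OF fam f] x unfolding idl_def by auto
  have "transition L p x \<in> ideal_gen (sections L (source C p)) (transition L p ` \<Lambda> (target C g) u f)"
    using x by (intro subsetD[OF subset_ideal_gen] imageI)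
  then have "transition L p x \<in> \<Lambda> (target C g) u (f \<cdot> p)"
    using idl_families_transition[OF fam f p'] by (rule subsetD[rotated])
  also have "\<Lambda> (target C g) u (f \<cdot> p) = transition (idl_presheaf C L) g (\<Lambda> (target C g) u) q"
    using q' eq by (simp add: idl_presheaf_def)
  also have "\<dots> = \<Lambda> (source C g) (transition L g u) q"
    using hom g u unfolding poset_presheaf_hom_def by simp
  finally have mem: "transition L p x \<in> \<Lambda> (source C g) (transition L g u) q" .
  have "transition L g u \<in> carrier (sections L (source C g))"
    using transition_closed[OF g] u by (rule funcset_mem)
  then have "Sig q (transition L p x) \<lless>\<^bsub>sections L (source C g)\<^esub> transition L g u"
    using source_closed[OF g] adj[OF source_closed[OF g]] q' mem
    by (intro Sig_left_adjoint_way_below)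
  then show ?thesis using Beck_Chevalley[OF pq xc] by simp
qed

lemma transition_way_below:
  assumes wp: "has_weak_pullbacks C" and lc: "internally_locally_compact C L Sig"
    and g: "g \<in> Arr C"
    and w: "w \<in> carrier (sections L (target C g))"
    and u: "u \<in> carrier (sections L (target C g))"
    and wu: "w \<lless>\<^bsub>sections L (target C g)\<^esub> u"
  shows "transition L g w \<lless>\<^bsub>sections L (source C g)\<^esub> transition L g u"
proof -
  let ?A = "sections L (target C g)" and ?B = "sections L (source C g)"
  have a: "target C g \<in> Obj C" and b: "source C g \<in> Obj C"
    using g by (auto intro: source_closed target_closed)
  interpret A: complete_lattice ?A using a by (rule sections_complete)
  obtain \<Lambda> where hom: "poset_presheaf_hom C L (idl_presheaf C L) \<Lambda>"
    and adj: "\<And>c. c \<in> Obj C \<Longrightarrow> left_adjoint (sections L c) (sections (idl_presheaf C L) c)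
      (\<Lambda> c) (internal_sup C L Sig c)"
    using lc unfolding internally_locally_compact_def by blast
  let ?S = "internal_sup C L Sig (target C g)" and ?I = "\<Lambda> (target C g) u"
  interpret G: galois_connection "\<lparr>orderA = ?A, orderB = sections (idl_presheaf C L) (target C g),
      lower = \<Lambda> (target C g), upper = ?S\<rparr>"
    using adj[OF a] unfolding left_adjoint_def .
  define W where "W = {z \<in> carrier ?A. transition L g z \<in> {x \<in> carrier ?B. x \<lless>\<^bsub>?B\<^esub> transition L g u}}"
  have clos: "transition L g \<in> carrier ?A \<rightarrow> carrier ?B" using g by (rule transition_closed)
  have W: "W \<in> idl ?A"
    unfolding W_def
  proof (rule sup_pres_vimage_idl)
    show "sup_pres ?A ?B (transition L g)"
      using transition_frame_hom[OF g] unfolding frame_hom_def by blast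
    show "{x \<in> carrier ?B. x \<lless>\<^bsub>?B\<^esub> transition L g u} \<in> idl ?B"
      using sections_complete[OF b] funcset_mem[OF clos u] by (rule way_below_idl)
  qed (fact clos)
  have Wc: "W \<subseteq> carrier ?A" unfolding W_def by blast
  have fam: "?I \<in> idl_families C L (target C g)"
    using G.lower_closed u by (simp add: idl_presheaf_def)
  \<comment> \<open>It suffices that \<open>W\<close> contains the elements whose supremum is \<open>S\<^sub>a (\<Lambda>\<^sub>a u)\<close>.\<close>
  have "Sig f ` ?I f \<subseteq> W" if f: "f \<in> arrows_into C (target C g)" for f
    using transition_Sig_way_below[OF wp hom adj g u f] Sig_image_subset_carrier[OF fam f] clos
    unfolding W_def by blast
  then have "?S ?I \<sqsubseteq>\<^bsub>?A\<^esub> \<Squnion>\<^bsub>?A\<^esub>W"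
    by (rule internal_sup_le_Sup_idl[OF a W])
  moreover have "u \<sqsubseteq>\<^bsub>?A\<^esub> ?S ?I" using G.inflation u by simp
  moreover have "?S ?I \<in> carrier ?A" using G.upper_closed G.lower_closed u by simp
  ultimately have "u \<sqsubseteq>\<^bsub>?A\<^esub> \<Squnion>\<^bsub>?A\<^esub>W" using A.le_trans[of u "?S ?I"] u Wc by simp
  \<comment> \<open>As an ideal, \<open>W\<close> is directed, so \<open>w \<lless> u\<close> applies to it.\<close>
  then obtain z where "z \<in> W" "w \<sqsubseteq>\<^bsub>?A\<^esub> z"
    using wu directed_idl[OF sections_complete[OF a] W] unfolding way_below_def by blast
  then have "w \<in> W" using W w unfolding idl_def by blast
  then show ?thesis unfolding W_def by blast
qed

end

theorem proposition3p2:
  fixes C :: "('o, 'm) cat"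
    and L :: "('o, 'm, 'x) presheaf"
    and Sig :: "'m \<Rightarrow> 'x \<Rightarrow> 'x"
    and a b :: 'o and g :: 'm and w u :: 'x
  assumes "small_category C"
    and "has_weak_pullbacks C"
    and "internal_frame C L Sig"
    and "internally_locally_compact C L Sig"
    and "g \<in> Arr C" "source C g = b" "target C g = a"
    and "w \<in> carrier (sections L a)" "u \<in> carrier (sections L a)"
    and "w \<lless>\<^bsub>sections L a\<^esub> u"
  shows "transition L g w \<lless>\<^bsub>sections L b\<^esub> transition L g u"
  using internal_frame.transition_way_below[OF assms(3,2,4,5)] assms(6-) by simp

end
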